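(* Let $X$ be a topological space, $Y$ a regular topological space, $D$ a dense subset of $X$, and $f:D\to Y$ a continuous map. Then $f$ extends to a continuous map $\widetilde f:X\to Y$ if and only if for every point $x\in X$ the filter $f(\mathcal F_x)$ is convergent in $Y$.
   Context: Regular spaces are assumed to be $T_1$ (hence Hausdorff), following Engelking's convention. For $x\in X$, $\mathcal F_x$ denotes the trace on $D$ of the filter of all neighbourhoods of $x$ in $X$, i.e. the filter on $D$ consisting of the sets $U\cap D$ with $U$ a neighbourhood of $x$. For a filter $\mathcal F$ on $D$, $f(\mathcal F)$ is the filter on $Y$ generated by the base $\{f(F):F\in\mathcal F\}$. A filter on a topological space converges to a point if it contains every neighbourhood of the point; it is convergent if it converges to at least one point. *)

theory Defs
  imports "HOL-Analysis.Analysis"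
begin

(* A filter on a subset S of a type is encoded as a filter on the whole type
   below "principal S"; its members contained in S form the filter on S. *)

definition trace_filter :: "'a topology \<Rightarrow> 'a set \<Rightarrow> 'a \<Rightarrow> 'a filter"
  where "trace_filter X D x = inf (nhdsin X x) (principal D)"

(* The topspace condition is needed because nhdsin Y y is bot (all sets are
   members) when y lies outside topspace Y. *)
definition filter_converges_to :: "'b topology \<Rightarrow> 'b filter \<Rightarrow> 'b \<Rightarrow> bool"
  where "filter_converges_to Y G y \<longleftrightarrow> y \<in> topspace Y \<and> G \<le> nhdsin Y y"

definition filter_convergent_in :: "'b topology \<Rightarrow> 'b filter \<Rightarrow> bool"
  where "filter_convergent_in Y G \<longleftrightarrow> (\<exists>y. filter_converges_to Y G y)"

lemma eventually_trace_filter: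
  assumes "x \<in> topspace X"
  shows "eventually P (trace_filter X D x) \<longleftrightarrow>
    (\<exists>U. openin X U \<and> x \<in> U \<and> (\<forall>d \<in> U \<inter> D. P d))"
  using assms
  by (auto simp: trace_filter_def eventually_inf_principal eventually_nhdsin)

lemma filter_converges_to_iff:
  "filter_converges_to Y G y \<longleftrightarrow>
    y \<in> topspace Y \<and> (\<forall>N. (\<exists>V. openin Y V \<and> y \<in> V \<and> V \<subseteq> N) \<longrightarrow> eventually (\<lambda>z. z \<in> N) G)"
proof (cases "y \<in> topspace Y")
  case True
  have "G \<le> nhdsin Y y \<longleftrightarrow>
      (\<forall>P. (\<exists>V. openin Y V \<and> y \<in> V \<and> (\<forall>z\<in>V. P z)) \<longrightarrow> eventually P G)"
    using True by (simp add: le_filter_def eventually_nhdsin)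
  also have "\<dots> \<longleftrightarrow>
      (\<forall>N. (\<exists>V. openin Y V \<and> y \<in> V \<and> V \<subseteq> N) \<longrightarrow> eventually (\<lambda>z. z \<in> N) G)"
    (is "?L \<longleftrightarrow> ?R")
  proof
    show "?L \<Longrightarrow> ?R" by (simp add: subset_iff Ball_def)
  next
    assume R: ?R
    show ?L
    proof (intro allI impI)
      fix P assume "\<exists>V. openin Y V \<and> y \<in> V \<and> (\<forall>z\<in>V. P z)"
      then show "eventually P G"
        using R[rule_format, of "{z. P z}"] by (auto simp: subset_iff)
    qed
  qed
  finally show ?thesis using True by (simp add: filter_converges_to_def)
qed (simp add: filter_converges_to_def)

end

theory Submission
  imports Defs
begin

text \<open>
  The forward direction is the usual fact that a continuous \<open>g\<close> maps the neighbourhood filter of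
  \<open>x\<close> to a filter converging to \<open>g x\<close>; on the trace filter \<open>g\<close> agrees with \<open>f\<close>.

  For the converse, choose for every \<open>x\<close> a limit \<open>g x\<close> of the image of the trace filter, taking
  \<open>f x\<close> itself when \<open>x \<in> D\<close> (it is a limit by continuity of \<open>f\<close>). If \<open>f\<close> maps the trace on \<open>D\<close>
  of an open set \<open>U\<close> into a closed set \<open>C\<close>, then \<open>g\<close> maps all of \<open>U\<close> into \<open>C\<close>: for
  \<open>z \<in> U\<close> the value \<open>g z\<close> is a limit of values of \<open>f\<close> on \<open>U \<inter> D\<close>, by density of \<open>D\<close>. Regularity of
  \<open>Y\<close> says that closed neighbourhoods form a neighbourhood base, so this control of closed sets
  suffices for continuity of \<open>g\<close>.
\<close>

lemma filter_converges_to_filtermap_trace: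
  assumes "x \<in> topspace X"
  shows "filter_converges_to Y (filtermap f (trace_filter X D x)) y \<longleftrightarrow>
    y \<in> topspace Y \<and>
    (\<forall>V. openin Y V \<and> y \<in> V \<longrightarrow> (\<exists>U. openin X U \<and> x \<in> U \<and> f ` (U \<inter> D) \<subseteq> V))"
proof -
  let ?G = "filtermap f (trace_filter X D x)"
  have ev: "eventually (\<lambda>z. z \<in> N) ?G \<longleftrightarrow> (\<exists>U. openin X U \<and> x \<in> U \<and> f ` (U \<inter> D) \<subseteq> N)" for N
    using assms by (simp add: eventually_filtermap eventually_trace_filter image_subset_iff)
  show ?thesis
    unfolding filter_converges_to_iff ev
  proof (intro conj_cong refl iffI allI impI)
    fix V assume R: "\<forall>N. (\<exists>V. openin Y V \<and> y \<in> V \<and> V \<subseteq> N) \<longrightarrow>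
        (\<exists>U. openin X U \<and> x \<in> U \<and> f ` (U \<inter> D) \<subseteq> N)" and "openin Y V \<and> y \<in> V"
    then have "\<exists>V'. openin Y V' \<and> y \<in> V' \<and> V' \<subseteq> V"
      by (intro exI[of _ V]) simp
    then show "\<exists>U. openin X U \<and> x \<in> U \<and> f ` (U \<inter> D) \<subseteq> V"
      by (rule R[rule_format])
  next
    fix N assume R: "\<forall>V. openin Y V \<and> y \<in> V \<longrightarrow>
        (\<exists>U. openin X U \<and> x \<in> U \<and> f ` (U \<inter> D) \<subseteq> V)" and "\<exists>V. openin Y V \<and> y \<in> V \<and> V \<subseteq> N"
    then obtain V where V: "openin Y V" "y \<in> V" "V \<subseteq> N"
      by blast
    then obtain U where "openin X U" "x \<in> U" "f ` (U \<inter> D) \<subseteq> V"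
      using R[rule_format, of V] by auto
    with V show "\<exists>U. openin X U \<and> x \<in> U \<and> f ` (U \<inter> D) \<subseteq> N"
      by (intro exI[of _ U]) auto
  qed
qed

lemma continuous_map_imp_trace_converges:
  assumes g: "continuous_map X Y g" and x: "x \<in> topspace X" and eq: "\<And>d. d \<in> D \<Longrightarrow> g d = f d"
  shows "filter_converges_to Y (filtermap f (trace_filter X D x)) (g x)"
  unfolding filter_converges_to_filtermap_trace[OF x]
proof (intro conjI allI impI)
  show "g x \<in> topspace Y"
    using g x by (auto simp: continuous_map_def)
next
  fix V assume V: "openin Y V \<and> g x \<in> V"
  have "topcontinuous_at X Y g x"
    using g x by (simp add: continuous_map_eq_topcontinuous_at)
  with V obtain U where "openin X U" "x \<in> U" "\<forall>z\<in>U. g z \<in> V"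
    unfolding topcontinuous_at_def by meson
  then show "\<exists>U. openin X U \<and> x \<in> U \<and> f ` (U \<inter> D) \<subseteq> V"
    using eq by (intro exI[of _ U]) auto
qed

lemma continuous_map_subtopology_imp_trace_converges:
  assumes f: "continuous_map (subtopology X D) Y f" and x: "x \<in> topspace X" "x \<in> D"
  shows "filter_converges_to Y (filtermap f (trace_filter X D x)) (f x)"
  unfolding filter_converges_to_filtermap_trace[OF x(1)]
proof (intro conjI allI impI)
  show "f x \<in> topspace Y"
    using f x by (auto simp: continuous_map_def)
next
  fix V assume V: "openin Y V \<and> f x \<in> V"
  have "topcontinuous_at (subtopology X D) Y f x"
    using f x by (simp add: continuous_map_eq_topcontinuous_at)
  with V obtain T where "openin (subtopology X D) T" "x \<in> T" "\<forall>z\<in>T. f z \<in> V"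
    unfolding topcontinuous_at_def by meson
  then show "\<exists>U. openin X U \<and> x \<in> U \<and> f ` (U \<inter> D) \<subseteq> V"
    by (auto simp: openin_subtopology)
qed

text \<open>
  The step that uses density: were the limit \<open>y\<close> outside \<open>C\<close>, the open complement of \<open>C\<close> would
  contain the values of \<open>f\<close> on the trace of some neighbourhood of \<open>z\<close>, and that neighbourhood
  meets \<open>U\<close> in a point of \<open>D\<close>.
\<close>
lemma trace_limit_in_closedin:
  assumes dense: "X closure_of D = topspace X"
    and U: "openin X U" "z \<in> U" and C: "closedin Y C" "f ` (U \<inter> D) \<subseteq> C"
    and y: "filter_converges_to Y (filtermap f (trace_filter X D z)) y"
  shows "y \<in> C"
proof (rule ccontr)
  assume "y \<notin> C"
  have z: "z \<in> topspace X"
    using U openin_subset by blast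
  have "openin Y (topspace Y - C)" "y \<in> topspace Y - C"
    using C y \<open>y \<notin> C\<close> by (auto simp: filter_converges_to_def)
  then obtain U' where U': "openin X U'" "z \<in> U'" "f ` (U' \<inter> D) \<subseteq> topspace Y - C"
    using y unfolding filter_converges_to_filtermap_trace[OF z] by meson
  have "z \<in> X closure_of D" "openin X (U \<inter> U')" "z \<in> U \<inter> U'"
    using z dense U U' by auto
  then obtain d where "d \<in> D" "d \<in> U \<inter> U'"
    unfolding in_closure_of by blast
  then show False
    using C U' by blast
qed

lemma continuous_map_trace_limits:
  assumes reg: "regular_space Y" and dense: "X closure_of D = topspace X"
    and lim: "\<And>x. x \<in> topspace X \<Longrightarrow>
      filter_converges_to Y (filtermap f (trace_filter X D x)) (g x)"
  shows "continuous_map X Y g"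
  unfolding continuous_map_eq_topcontinuous_at topcontinuous_at_def
proof (intro ballI conjI allI impI)
  show "g \<in> topspace X \<rightarrow> topspace Y"
    using lim by (auto simp: filter_converges_to_def)
next
  fix x W assume x: "x \<in> topspace X" and W: "openin Y W \<and> g x \<in> W"
  then obtain V C where V: "openin Y V" "g x \<in> V" and C: "closedin Y C" "V \<subseteq> C" "C \<subseteq> W"
    using reg unfolding neighbourhood_base_of_closedin[symmetric] neighbourhood_base_of
    by meson
  then obtain U where U: "openin X U" "x \<in> U" "f ` (U \<inter> D) \<subseteq> V"
    using lim[OF x] unfolding filter_converges_to_filtermap_trace[OF x] by meson
  have "g z \<in> W" if "z \<in> U" for z
  proof -
    have "z \<in> topspace X"
      using U that openin_subset by blast
    then have "g z \<in> C"
      using trace_limit_in_closedin[OF dense U(1) that C(1) _ lim] U(3) C(2) by blast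
    then show ?thesis
      using C by blast
  qed
  then show "\<exists>U. openin X U \<and> x \<in> U \<and> (\<forall>z\<in>U. g z \<in> W)"
    using U by blast
qed

theorem mainTheorem5:
  fixes X :: "'a topology" and Y :: "'b topology" and D :: "'a set" and f :: "'a \<Rightarrow> 'b"
  assumes "regular_space Y" and "t1_space Y"
    and "D \<subseteq> topspace X" and "X closure_of D = topspace X"
    and "continuous_map (subtopology X D) Y f"
  shows "(\<exists>g. continuous_map X Y g \<and> (\<forall>d\<in>D. g d = f d)) \<longleftrightarrow>
    (\<forall>x\<in>topspace X. filter_convergent_in Y (filtermap f (trace_filter X D x)))"
proof
  assume "\<exists>g. continuous_map X Y g \<and> (\<forall>d\<in>D. g d = f d)"
  then show "\<forall>x\<in>topspace X. filter_convergent_in Y (filtermap f (trace_filter X D x))"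
    unfolding filter_convergent_in_def by (metis continuous_map_imp_trace_converges)
next
  assume "\<forall>x\<in>topspace X. filter_convergent_in Y (filtermap f (trace_filter X D x))"
  then obtain l where l: "\<And>x. x \<in> topspace X \<Longrightarrow>
      filter_converges_to Y (filtermap f (trace_filter X D x)) (l x)"
    unfolding filter_convergent_in_def by metis
  define g where "g x = (if x \<in> D then f x else l x)" for x
  have "filter_converges_to Y (filtermap f (trace_filter X D x)) (g x)"
    if "x \<in> topspace X" for x
    using that l continuous_map_subtopology_imp_trace_converges[OF assms(5)]
    by (simp add: g_def)
  then have "continuous_map X Y g"
    using continuous_map_trace_limits assms(1,4) by blast
  then show "\<exists>g. continuous_map X Y g \<and> (\<forall>d\<in>D. g d = f d)"
    by (auto simp: g_def)
qed

end
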